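(* Let $d=d_X+d_Z$ and suppose $g(x,z):[0,1]^d\to\mathbb{R}$ is such that $g(x,z)\ge a>0$ for some constant $a$, and $g$ is Hölder smooth with smoothness $\beta>1$ in both $x$ and $z$, i.e., with $\ell=\lfloor\beta\rfloor$, $g$ is $\ell$ times differentiable and for some constant $C$ $$|D^\alpha g(x,z)-D^\alpha g(x',z')|\le C\,(\|x-x'\|_1+\|z-z'\|_1)^{\beta-\ell}$$ for all $(x,z),(x',z')\in[0,1]^d$ and all $\alpha\in\mathbb{N}_0^{d}$ with $\|\alpha\|_1=\ell$. If $p_{X|Z}(x|z)=\frac{g(x,z)}{\int g(x,z)\,dx}$, then $p_{X|Z}\in\mathcal{P}_{\beta,1}\subseteq\mathcal{P}_{\beta,\gamma}$ for any $0<\gamma\le 1$.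
   Context: $x\in[0,1]^{d_X}$, $z\in[0,1]^{d_Z}$; the integral in $x$ is over $[0,1]^{d_X}$. $\lfloor\beta\rfloor$ denotes the greatest integer strictly less than $\beta$; $D^\alpha$ is the partial derivative of multi-index $\alpha$ (in the variables $(x,z)$ for $\alpha\in\mathbb{N}_0^{d}$). The class $\mathcal{P}_{\beta,\gamma}$ (for $\beta>0$, $0<\gamma\le1$): a conditional density $p_{X|Z}$ (with any marginal density $p_Z$ on $[0,1]^{d_Z}$) belongs to $\mathcal{P}_{\beta,\gamma}$ if, for some constants $W_1,W_2>0$ ($W_2$ sufficiently large; the values of the constants are not tracked in the membership and inclusion asserted): (Hölder smoothness in $x$) $p_{X|Z}(x|z)$ is $\ell=\lfloor\beta\rfloor$ times differentiable in $x$ and for all $x,x'\in[0,1]^{d_X}$, $z\in[0,1]^{d_Z}$ and $\alpha\in\mathbb{N}_0^{d_X}$ with $\|\alpha\|_1=\ell$: $|D^\alpha p_{X|Z}(x|z)-D^\alpha p_{X|Z}(x'|z)|\le W_1\|x-x'\|_1^{\beta-\ell}$; ($\gamma$-TV smoothness in $z$) for all $z,z'\in[0,1]^{d_Z}$: $\int|p_{X|Z}(x|z)-p_{X|Z}(x|z')|dx\le W_2\|z-z'\|_1^\gamma$. *)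

theory Defs
  imports "HOL-Analysis.Analysis"
begin

definition l1_norm :: "real^'n \<Rightarrow> real" where
  "l1_norm x = (\<Sum>i\<in>UNIV. \<bar>x $ i\<bar>)"

abbreviation unit_cube :: "(real^'n) set" where
  "unit_cube \<equiv> cbox 0 1"

text \<open>The greatest integer strictly less than \<open>b\<close>, so \<open>strict_floor n = n - 1\<close> for integers
  \<open>n \<ge> 1\<close>; only used for \<open>b > 0\<close>, where it is a natural number.\<close>

definition strict_floor :: "real \<Rightarrow> nat" where
  "strict_floor b = nat (\<lceil>b\<rceil> - 1)"

lemma strict_floor_greatest:
  assumes "b > 0"
  shows "real (strict_floor b) < b"
    and "of_int k < b \<Longrightarrow> k \<le> int (strict_floor b)"
  using assms unfolding strict_floor_def by linarith+

text \<open>Derivatives are taken within the set \<open>S\<close>, i.e. they are one-sided at the boundary of a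
  closed cube. On a nondegenerate closed cube the derivative within \<open>S\<close> is unique, and it depends
  only on the values of the function on \<open>S\<close>.\<close>

definition partial_deriv ::
    "'a::euclidean_space set \<Rightarrow> 'a \<Rightarrow> ('a \<Rightarrow> real) \<Rightarrow> 'a \<Rightarrow> real" where
  "partial_deriv S v f = (\<lambda>x. frechet_derivative f (at x within S) v)"

primrec times_differentiable_on ::
    "nat \<Rightarrow> ('a::euclidean_space \<Rightarrow> real) \<Rightarrow> 'a set \<Rightarrow> bool" where
  "times_differentiable_on 0 f S \<longleftrightarrow> True"
| "times_differentiable_on (Suc k) f S \<longleftrightarrow>
     f differentiable_on S \<and>
     (\<forall>v\<in>Basis. times_differentiable_on k (partial_deriv S v f) S)"

definition mi_order :: "nat^'n \<Rightarrow> nat" where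
  "mi_order \<alpha> = (\<Sum>i\<in>UNIV. \<alpha> $ i)"

text \<open>A fixed enumeration of the coordinates. It only fixes the order in which the partial
  derivatives of a multi-index are taken; this order is immaterial for derivatives of order at
  most \<open>k\<close> of a function that is \<open>k\<close> times differentiable.\<close>

definition coords :: "'n::finite list" where
  "coords = (SOME is. distinct is \<and> set is = UNIV)"

definition mi_directions :: "nat^'n \<Rightarrow> (real^'n) list" where
  "mi_directions \<alpha> = concat (map (\<lambda>i. replicate (\<alpha> $ i) (axis i 1)) coords)"

definition mi_deriv ::
    "(real^'n) set \<Rightarrow> nat^'n \<Rightarrow> (real^'n \<Rightarrow> real) \<Rightarrow> real^'n \<Rightarrow> real" where
  "mi_deriv S \<alpha> f = foldr (partial_deriv S) (mi_directions \<alpha>) f"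

text \<open>The same in the joint variables \<open>(x, z)\<close>; a multi-index of length \<open>dx + dz\<close> is a pair
  of multi-indices of lengths \<open>dx\<close> and \<open>dz\<close>.\<close>

definition mi_deriv_joint ::
    "((real^'dx) \<times> (real^'dz)) set \<Rightarrow> (nat^'dx) \<times> (nat^'dz) \<Rightarrow> ((real^'dx) \<times> (real^'dz) \<Rightarrow> real)
      \<Rightarrow> (real^'dx) \<times> (real^'dz) \<Rightarrow> real" where
  "mi_deriv_joint S \<alpha> f =
     foldr (partial_deriv S)
       (map (\<lambda>v. (v, 0)) (mi_directions (fst \<alpha>)) @ map (\<lambda>v. (0, v)) (mi_directions (snd \<alpha>))) f"

text \<open>Here and below \<open>p x z\<close> stands for \<open>p(x | z)\<close>, and only its values on the cubes matter. The
  Bochner integral of a nonintegrable function is 0, so the last clause entails integrability.\<close>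

definition cond_density :: "(real^'dx \<Rightarrow> real^'dz \<Rightarrow> real) \<Rightarrow> bool" where
  "cond_density p \<longleftrightarrow>
     set_borel_measurable borel (unit_cube \<times> unit_cube) (\<lambda>(x, z). p x z) \<and>
     (\<forall>x\<in>unit_cube. \<forall>z\<in>unit_cube. 0 \<le> p x z) \<and>
     (\<forall>z\<in>unit_cube. (LINT x:unit_cube|lborel. p x z) = 1)"

definition holder_class :: "real \<Rightarrow> real \<Rightarrow> (real^'dx \<Rightarrow> real^'dz \<Rightarrow> real) set" where
  "holder_class \<beta> \<gamma> = {p. cond_density p \<and>
     (\<exists>W\<^sub>1>0. \<exists>W\<^sub>2>0.
       (\<forall>z\<in>unit_cube. times_differentiable_on (strict_floor \<beta>) (\<lambda>x. p x z) unit_cube) \<and>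
       (\<forall>x\<in>unit_cube. \<forall>x'\<in>unit_cube. \<forall>z\<in>unit_cube. \<forall>\<alpha>. mi_order \<alpha> = strict_floor \<beta> \<longrightarrow>
          \<bar>mi_deriv unit_cube \<alpha> (\<lambda>x. p x z) x - mi_deriv unit_cube \<alpha> (\<lambda>x. p x z) x'\<bar>
            \<le> W\<^sub>1 * l1_norm (x - x') powr (\<beta> - real (strict_floor \<beta>))) \<and>
       (\<forall>z\<in>unit_cube. \<forall>z'\<in>unit_cube.
          (LINT x:unit_cube|lborel. \<bar>p x z - p x z'\<bar>) \<le> W\<^sub>2 * l1_norm (z - z') powr \<gamma>))}"

end

theory Submission
  imports Defs
begin

text \<open>
  Write \<open>I(z)\<close> for the normalising integral \<open>\<integral> g(u, z) du\<close>, so that \<open>p(x | z) = g(x, z) / I(z)\<close> and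
  \<open>I(z) \<ge> a\<close>, because \<open>g \<ge> a\<close> on a cube of volume one.

  Smoothness in \<open>x\<close>: for fixed \<open>z\<close> the function \<open>p(\<cdot> | z)\<close> is the constant \<open>1 / I(z) \<le> 1 / a\<close> times
  the restriction of \<open>g\<close> to a slice of the joint cube. A partial derivative of the slice is the slice
  of the corresponding partial derivative (\<open>foldr_partial_deriv_pullback\<close>), so the Hoelder bound for
  the derivatives of \<open>g\<close> in the \<open>x\<close> directions gives the one for \<open>p\<close> with constant \<open>\<bar>C\<bar> / a\<close>.

  Smoothness in \<open>z\<close>: let \<open>\<ell>\<close> be the greatest integer below \<open>\<beta>\<close>. Since \<open>\<beta> > 1\<close>, the first partial derivatives of \<open>g\<close> exist and are bounded on
  the cube: for \<open>\<ell> = 1\<close> they are themselves Hoelder, and for \<open>\<ell> \<ge> 2\<close> they are differentiable, hence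
  continuous on a compact set. By the mean value theorem \<open>g\<close> is then Lipschitz in \<open>z\<close> with some
  constant \<open>L\<close>, uniformly in \<open>x\<close> (\<open>lipschitz_in_second_argument\<close>). Normalising two functions that
  differ by at most \<open>\<epsilon>\<close> and have integrals at least \<open>a\<close> yields densities with distance at most
  \<open>2 \<epsilon> / a\<close> in \<open>L\<^sup>1\<close> (\<open>normalised_L1_distance\<close>); with \<open>\<epsilon> = L \<parallel>z - z'\<parallel>\<^sub>1\<close> this is the TV bound.

  The classes are nested in \<open>\<gamma>\<close> because \<open>\<parallel>z - z'\<parallel>\<^sub>1\<close> is bounded by the dimension on the cube, so that
  its first power is at most a constant times its power \<open>\<gamma> \<le> 1\<close>.
\<close>

section \<open>Iterated partial derivatives along an affine map\<close>

text \<open>Slicing a function and dividing it by a constant are handled together: both are instances of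
  \<open>q = c \<cdot> (f \<circ> h)\<close> with \<open>h\<close> affine with linear part \<open>A\<close>. The equation for \<open>q\<close> is asked for on
  the box only, so that the lemma can be iterated. Nondegeneracy of the box makes the derivative within
  it unique, so the chain rule determines the value of \<open>partial_deriv\<close>.\<close>

lemma partial_deriv_pullback:
  fixes l u :: "'a::euclidean_space" and f :: "'b::euclidean_space \<Rightarrow> real"
  assumes box: "\<And>i. i \<in> Basis \<Longrightarrow> l \<bullet> i < u \<bullet> i"
    and h: "\<And>y. y \<in> cbox l u \<Longrightarrow> (h has_derivative A) (at y within cbox l u)"
    and hS: "h ` cbox l u \<subseteq> T"
    and f: "f differentiable_on T"
    and q: "\<And>y. y \<in> cbox l u \<Longrightarrow> q y = c * f (h y)"
    and y: "y \<in> cbox l u"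
  shows "q differentiable (at y within cbox l u)"
    and "partial_deriv (cbox l u) v q y = c * partial_deriv T (A v) f (h y)"
proof -
  have "(f has_derivative frechet_derivative f (at w within T)) (at w within T)" if "w \<in> T" for w
    using f that by (simp add: differentiable_on_def frechet_derivative_works)
  from has_derivative_in_compose2[where g' = "\<lambda>w. frechet_derivative f (at w within T)",
      OF this hS y h[OF y]]
  have "((\<lambda>y. c * f (h y)) has_derivative
      (\<lambda>v. c * frechet_derivative f (at (h y) within T) (A v))) (at y within cbox l u)"
    by (rule has_derivative_mult_right)
  then have D: "(q has_derivative
      (\<lambda>v. c * frechet_derivative f (at (h y) within T) (A v))) (at y within cbox l u)"
    by (rule has_derivative_transform[OF y q, rotated])
  then show "q differentiable (at y within cbox l u)"
    by (rule differentiableI)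
  show "partial_deriv (cbox l u) v q y = c * partial_deriv T (A v) f (h y)"
    using frechet_derivative_within_cbox[OF box y D] by (simp add: partial_deriv_def)
qed

lemma times_differentiable_on_pullback:
  fixes l u :: "'a::euclidean_space" and f :: "'b::euclidean_space \<Rightarrow> real"
  assumes box: "\<And>i. i \<in> Basis \<Longrightarrow> l \<bullet> i < u \<bullet> i"
    and h: "\<And>y. y \<in> cbox l u \<Longrightarrow> (h has_derivative A) (at y within cbox l u)"
    and hS: "h ` cbox l u \<subseteq> T"
    and A: "A ` Basis \<subseteq> Basis"
    and f: "times_differentiable_on k f T"
    and q: "\<And>y. y \<in> cbox l u \<Longrightarrow> q y = c * f (h y)"
  shows "times_differentiable_on k q (cbox l u)"
  using f q
proof (induction k arbitrary: f q)
  case (Suc k)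
  then have f: "f differentiable_on T" by simp
  have "times_differentiable_on k (partial_deriv (cbox l u) v q) (cbox l u)" if "v \<in> Basis" for v
  proof (rule Suc.IH)
    show "times_differentiable_on k (partial_deriv T (A v) f) T"
      using Suc.prems(1) A that by auto
    show "partial_deriv (cbox l u) v q y = c * partial_deriv T (A v) f (h y)"
      if "y \<in> cbox l u" for y
      by (rule partial_deriv_pullback(2)[OF box h hS f Suc.prems(2) that])
  qed
  moreover have "q differentiable_on cbox l u"
    unfolding differentiable_on_def
    using partial_deriv_pullback(1)[OF box h hS f Suc.prems(2)] by blast
  ultimately show ?case by simp
qed simp

text \<open>The innermost derivative is taken first, so the loss of one order of differentiability has to
  be tracked from the end of the list.\<close>

lemma times_differentiable_on_foldr:
  assumes "times_differentiable_on (length vs + k) f S" and "set vs \<subseteq> Basis"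
  shows "times_differentiable_on k (foldr (partial_deriv S) vs f) S"
  using assms
proof (induction vs arbitrary: k)
  case (Cons v vs)
  then have "times_differentiable_on (Suc k) (foldr (partial_deriv S) vs f) S"
    by (intro Cons.IH) auto
  with Cons.prems show ?case by simp
qed simp

lemma foldr_partial_deriv_pullback:
  fixes l u :: "'a::euclidean_space" and f :: "'b::euclidean_space \<Rightarrow> real"
  assumes box: "\<And>i. i \<in> Basis \<Longrightarrow> l \<bullet> i < u \<bullet> i"
    and h: "\<And>y. y \<in> cbox l u \<Longrightarrow> (h has_derivative A) (at y within cbox l u)"
    and hS: "h ` cbox l u \<subseteq> T"
    and A: "A ` Basis \<subseteq> Basis"
    and f: "times_differentiable_on (length vs) f T"
    and vs: "set vs \<subseteq> Basis"
    and q: "\<And>y. y \<in> cbox l u \<Longrightarrow> q y = c * f (h y)"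
    and y: "y \<in> cbox l u"
  shows "foldr (partial_deriv (cbox l u)) vs q y = c * foldr (partial_deriv T) (map A vs) f (h y)"
proof -
  have "foldr (partial_deriv (cbox l u)) vs q y = c * foldr (partial_deriv T) (map A vs) f (h y)"
    if "length vs \<le> k" "times_differentiable_on k f T" "set vs \<subseteq> Basis" "y \<in> cbox l u" for k y
    using that
  proof (induction vs arbitrary: y)
    case Nil
    then show ?case by (simp add: q)
  next
    case (Cons v vs)
    from Cons.prems(1) have len: "k = length (map A vs) + Suc (k - length (v # vs))"
      by simp
    have "times_differentiable_on (Suc (k - length (v # vs)))
        (foldr (partial_deriv T) (map A vs) f) T"
      using Cons.prems A
      by (intro times_differentiable_on_foldr) (auto simp flip: len)
    then have "foldr (partial_deriv T) (map A vs) f differentiable_on T" by simp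
    then have "partial_deriv (cbox l u) v (foldr (partial_deriv (cbox l u)) vs q) y
        = c * partial_deriv T (A v) (foldr (partial_deriv T) (map A vs) f) (h y)"
      using Cons.prems by (intro partial_deriv_pullback(2)[OF box h hS] Cons.IH) auto
    then show ?case by simp
  qed
  from this[OF order_refl f vs y] show ?thesis .
qed

section \<open>Directions of a multi-index\<close>

lemma coords_enumerates: "distinct (coords :: 'n::finite list)" "set (coords :: 'n list) = UNIV"
proof -
  have "\<exists>is :: 'n list. distinct is \<and> set is = UNIV"
    using finite_distinct_list[of "UNIV :: 'n set"] by auto
  from someI_ex[OF this]
  show "distinct (coords :: 'n list)" "set (coords :: 'n list) = UNIV"
    unfolding coords_def by auto
qed

lemma set_mi_directions: "set (mi_directions \<alpha>) \<subseteq> Basis"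
  by (auto simp: mi_directions_def Basis_vec_def)

lemma length_mi_directions: "length (mi_directions \<alpha>) = mi_order \<alpha>"
  using sum_list_distinct_conv_sum_set[OF coords_enumerates(1), of "($) \<alpha>"]
  by (simp add: mi_directions_def mi_order_def length_concat comp_def coords_enumerates(2))

lemma mi_directions_zero: "mi_directions 0 = []"
  by (simp add: mi_directions_def)

lemma mi_order_zero: "mi_order 0 = 0"
  by (simp add: mi_order_def)

lemma mi_order_axis: "mi_order (axis i 1) = 1"
  by (simp add: mi_order_def axis_def)

lemma mi_directions_axis: "mi_directions (axis i 1 :: nat^'n) = [axis i 1]"
proof -
  have "concat (map (\<lambda>j. replicate ((axis i 1 :: nat^'n) $ j) (axis j (1::real))) js)
      = (if i \<in> set js then [axis i 1] else [])" if "distinct js" for js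
    using that by (induction js) (auto simp: axis_def)
  from this[OF coords_enumerates(1)] show ?thesis
    by (simp add: mi_directions_def coords_enumerates)
qed

lemma mi_deriv_joint_single_variable:
  "mi_deriv_joint S (\<alpha>, 0) f = foldr (partial_deriv S) (map (\<lambda>v. (v, 0)) (mi_directions \<alpha>)) f"
  "mi_deriv_joint S (0, axis i 1) f = partial_deriv S (0, axis i 1) f"
  by (simp_all add: mi_deriv_joint_def mi_directions_zero mi_directions_axis del: One_nat_def)

section \<open>The norm on the cube\<close>

lemma l1_norm_nonneg: "0 \<le> l1_norm x"
  by (simp add: l1_norm_def sum_nonneg)

lemma l1_norm_zero: "l1_norm 0 = 0"
  by (simp add: l1_norm_def)

lemma mem_unit_cube: "x \<in> unit_cube \<longleftrightarrow> (\<forall>i. 0 \<le> x $ i \<and> x $ i \<le> 1)"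
  by (simp add: mem_box_cart)

lemma zero_mem_unit_cube: "0 \<in> unit_cube"
  by (simp add: mem_unit_cube)

lemma unit_cube_nondegenerate: "i \<in> Basis \<Longrightarrow> (0 :: real^'n) \<bullet> i < 1 \<bullet> i"
  by (auto simp: Basis_vec_def inner_axis)

lemma l1_norm_diff_le_card:
  fixes x y :: "real^'n"
  assumes "x \<in> unit_cube" "y \<in> unit_cube"
  shows "l1_norm (x - y) \<le> real CARD('n)"
proof -
  have "\<bar>(x - y) $ i\<bar> \<le> 1" for i
    using assms by (auto simp: mem_unit_cube abs_le_iff vector_minus_component
        intro: order_trans[of _ "x $ i"] order_trans[of _ "y $ i"])
  then have "l1_norm (x - y) \<le> (\<Sum>i\<in>(UNIV :: 'n set). 1)"
    unfolding l1_norm_def by (intro sum_mono)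
  then show ?thesis by simp
qed

text \<open>On a bounded range the first power is controlled by any lower power: \<open>t = t\<^bsup>1 - \<gamma>\<^esup> t\<^bsup>\<gamma>\<^esup>\<close>.\<close>

lemma le_mult_powr:
  fixes t D \<gamma> :: real
  assumes "0 \<le> t" "t \<le> D" "1 \<le> D" "0 < \<gamma>" "\<gamma> \<le> 1"
  shows "t \<le> D * t powr \<gamma>"
proof (cases "t = 0")
  case False
  with assms have "t = t powr (1 - \<gamma>) * t powr \<gamma>"
    by (simp flip: powr_add)
  moreover have "t powr (1 - \<gamma>) \<le> D powr (1 - \<gamma>)"
    using assms by (intro powr_mono2) auto
  moreover have "D powr (1 - \<gamma>) \<le> D powr 1"
    using assms by (intro powr_mono) auto
  ultimately show ?thesis
    using assms by (metis mult_right_mono order_trans powr_ge_zero powr_one)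
qed (use assms in simp)

section \<open>Lipschitz continuity from bounded partial derivatives\<close>

text \<open>Mean value theorem along the segment from \<open>z'\<close> to \<open>z\<close>; expanding the derivative in the
  coordinate directions makes the \<open>\<ell>\<^sup>1\<close> norm of \<open>z - z'\<close> appear.\<close>

lemma lipschitz_of_bounded_partials:
  fixes q :: "real^'n \<Rightarrow> real"
  assumes S: "convex S" and q: "q differentiable_on S"
    and B: "\<And>i w. w \<in> S \<Longrightarrow> \<bar>partial_deriv S (axis i 1) q w\<bar> \<le> B"
    and z: "z \<in> S" "z' \<in> S"
  shows "\<bar>q z - q z'\<bar> \<le> B * l1_norm (z - z')"
proof -
  define F where "F w = frechet_derivative q (at w within S)" for w
  define s where "s t = z' + t *\<^sub>R (z - z')" for t :: real
  have F: "(q has_derivative F w) (at w within S)" if "w \<in> S" for w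
    using q that by (simp add: F_def differentiable_on_def frechet_derivative_works)
  have sS: "s t \<in> S" if "t \<in> {0..1}" for t
  proof -
    have "s t = (1 - t) *\<^sub>R z' + t *\<^sub>R z"
      by (simp add: s_def algebra_simps)
    then show ?thesis using S z that by (simp add: convexD_alt)
  qed
  have s: "(s has_derivative (\<lambda>r. r *\<^sub>R (z - z'))) (at t within {0..1})" for t
    unfolding s_def by (auto intro!: derivative_eq_intros)
  have "((\<lambda>t. q (s t)) has_derivative (\<lambda>r. F (s t) (r *\<^sub>R (z - z')))) (at t within {0..1})"
    if "0 \<le> t" "t \<le> 1" for t
    by (rule has_derivative_in_compose2[where t = S, OF F _ _ s]) (use sS that in auto)
  from mvt_very_simple[of 0 1, OF _ this] obtain t where t: "t \<in> {0..1}"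
    and eq: "q (s 1) - q (s 0) = F (s t) ((1 - 0) *\<^sub>R (z - z'))" by auto
  interpret linear "F (s t)"
    using F[OF sS[OF t]] by (rule has_derivative_linear)
  have "q z - q z' = F (s t) (z - z')"
    using eq by (simp add: s_def)
  also have "z - z' = (\<Sum>i\<in>UNIV. (z - z') $ i *\<^sub>R axis i 1)"
    unfolding scalar_mult_eq_scaleR[symmetric] basis_expansion ..
  also have "F (s t) \<dots> = (\<Sum>i\<in>UNIV. (z - z') $ i * F (s t) (axis i 1))"
    by (simp add: sum scale)
  finally have "\<bar>q z - q z'\<bar> \<le> (\<Sum>i\<in>UNIV. \<bar>(z - z') $ i * F (s t) (axis i 1)\<bar>)"
    by simp
  also have "\<dots> \<le> (\<Sum>i\<in>UNIV. \<bar>(z - z') $ i\<bar> * B)"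
    using B[OF sS[OF t]]
    by (intro sum_mono) (auto simp: abs_mult partial_deriv_def F_def intro!: mult_left_mono)
  also have "\<dots> = B * l1_norm (z - z')"
    by (simp add: l1_norm_def sum_distrib_left mult.commute)
  finally show ?thesis .
qed

lemma lipschitz_in_second_argument:
  fixes g :: "(real^'dx) \<times> (real^'dz) \<Rightarrow> real"
  assumes g: "g differentiable_on (unit_cube \<times> unit_cube)"
    and B: "\<And>i w. w \<in> unit_cube \<times> unit_cube \<Longrightarrow>
      \<bar>partial_deriv (unit_cube \<times> unit_cube) (0, axis i 1) g w\<bar> \<le> B"
    and x: "x \<in> unit_cube" and z: "z \<in> unit_cube" "z' \<in> unit_cube"
  shows "\<bar>g (x, z) - g (x, z')\<bar> \<le> B * l1_norm (z - z')"
proof (rule lipschitz_of_bounded_partials[where q = "\<lambda>z. g (x, z)", OF convex_box(1) _ _ z])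
  note pullback = partial_deriv_pullback[where h = "\<lambda>z. (x, z)" and A = "\<lambda>v. (0, v)" and f = g
      and q = "\<lambda>z. g (x, z)" and c = 1 and T = "unit_cube \<times> unit_cube", OF unit_cube_nondegenerate]
  have h: "((\<lambda>z. (x, z)) has_derivative (\<lambda>v. (0, v))) (at w within unit_cube)" for w :: "real^'dz"
    by (auto intro!: derivative_eq_intros)
  show "(\<lambda>z. g (x, z)) differentiable_on unit_cube"
    unfolding differentiable_on_def using x by (auto intro!: pullback(1) h g)
  show "\<bar>partial_deriv unit_cube (axis i 1) (\<lambda>z. g (x, z)) w\<bar> \<le> B" if w: "w \<in> unit_cube" for i w
  proof -
    have "partial_deriv unit_cube (axis i 1) (\<lambda>z. g (x, z)) w
        = 1 * partial_deriv (unit_cube \<times> unit_cube) (0, axis i 1) g (x, w)"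
      using x by (intro pullback(2) h g w) auto
    then show ?thesis using B[of "(x, w)" i] x w by simp
  qed
qed

section \<open>Integrals over the cube\<close>

lemma set_integrable_cube:
  "continuous_on unit_cube f \<Longrightarrow> set_integrable lborel unit_cube (f :: real^'n \<Rightarrow> real)"
  unfolding set_integrable_def by (rule borel_integrable_compact) auto

lemma content_unit_cube: "measure lborel (unit_cube :: (real^'n) set) = 1"
  by (subst content_cbox_cart) (use zero_mem_unit_cube in auto)

lemma integral_const_cube: "(LINT x:(unit_cube :: (real^'n) set)|lborel. (c :: real)) = c"
  by (subst set_integral_const) (auto simp: content_unit_cube emeasure_lborel_cbox_eq)

lemma integral_cube_mono:
  fixes f h :: "real^'n \<Rightarrow> real"
  assumes "continuous_on unit_cube f" "continuous_on unit_cube h"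
    and "\<And>x. x \<in> unit_cube \<Longrightarrow> f x \<le> h x"
  shows "(LINT x:unit_cube|lborel. f x) \<le> (LINT x:unit_cube|lborel. h x)"
  by (intro set_integral_mono set_integrable_cube assms)

text \<open>With \<open>I\<close> and \<open>J\<close> the integrals of \<open>f\<close> and \<open>h\<close>, the decomposition
  \<open>f / I - h / J = (f - h) / I + (h / J) (J - I) / I\<close> bounds the distance by \<open>\<epsilon> / I\<close> twice, since
  \<open>h / J\<close> has integral one and \<open>\<bar>J - I\<bar> \<le> \<epsilon>\<close>.\<close>

lemma normalised_L1_distance:
  fixes f h :: "real^'n \<Rightarrow> real"
  assumes f: "continuous_on unit_cube f" and h: "continuous_on unit_cube h"
    and h0: "\<And>x. x \<in> unit_cube \<Longrightarrow> 0 \<le> h x"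
    and \<epsilon>: "\<And>x. x \<in> unit_cube \<Longrightarrow> \<bar>f x - h x\<bar> \<le> \<epsilon>"
    and a: "0 < a" "a \<le> (LINT x:unit_cube|lborel. f x)" "a \<le> (LINT x:unit_cube|lborel. h x)"
  shows "(LINT x:unit_cube|lborel. \<bar>f x / (LINT x:unit_cube|lborel. f x)
      - h x / (LINT x:unit_cube|lborel. h x)\<bar>) \<le> 2 * \<epsilon> / a"
proof -
  define I where "I = (LINT x:unit_cube|lborel. f x)"
  define J where "J = (LINT x:unit_cube|lborel. h x)"
  have IJ: "0 < I" "0 < J" "a \<le> I" using a by (auto simp: I_def J_def)
  have \<epsilon>0: "0 \<le> \<epsilon>" using \<epsilon>[OF zero_mem_unit_cube] by linarith
  have "I \<le> (LINT x:unit_cube|lborel. h x + \<epsilon>)"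
    unfolding I_def
    by (intro integral_cube_mono continuous_intros f h) (use \<epsilon> in \<open>force simp: abs_le_iff\<close>)
  moreover have "(LINT x:unit_cube|lborel. h x + \<epsilon>) = J + \<epsilon>"
    unfolding J_def
    by (subst set_integral_add) (auto intro!: set_integrable_cube h simp: integral_const_cube)
  moreover have "J \<le> (LINT x:unit_cube|lborel. f x + \<epsilon>)"
    unfolding J_def
    by (intro integral_cube_mono continuous_intros f h) (use \<epsilon> in \<open>force simp: abs_le_iff\<close>)
  moreover have "(LINT x:unit_cube|lborel. f x + \<epsilon>) = I + \<epsilon>"
    unfolding I_def
    by (subst set_integral_add) (auto intro!: set_integrable_cube f simp: integral_const_cube)
  ultimately have JI: "\<bar>J - I\<bar> \<le> \<epsilon>" by linarith
  define \<kappa> where "\<kappa> = \<epsilon> / (J * I)"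
  have ptw: "\<bar>f x / I - h x / J\<bar> \<le> \<epsilon> / I + h x * \<kappa>" if x: "x \<in> unit_cube" for x
  proof -
    have "f x / I - h x / J = (f x - h x) / I + h x * ((J - I) / (J * I))"
      using IJ by (simp add: field_simps)
    also have "\<bar>\<dots>\<bar> \<le> \<bar>f x - h x\<bar> / I + h x * (\<bar>J - I\<bar> / (J * I))"
      using IJ h0[OF x] by (intro order_trans[OF abs_triangle_ineq]) (simp add: abs_mult)
    also have "\<dots> \<le> \<epsilon> / I + h x * (\<epsilon> / (J * I))"
      using IJ h0[OF x] \<epsilon>[OF x] JI by (intro add_mono mult_left_mono divide_right_mono) auto
    finally show ?thesis unfolding \<kappa>_def .
  qed
  have "(LINT x:unit_cube|lborel. \<bar>f x / I - h x / J\<bar>)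
      \<le> (LINT x:unit_cube|lborel. \<epsilon> / I + h x * \<kappa>)"
    using IJ by (intro integral_cube_mono continuous_intros f h ptw) auto
  also have "\<dots> = \<epsilon> / I + (LINT x:unit_cube|lborel. h x) * \<kappa>"
    by (subst set_integral_add)
      (auto intro!: set_integrable_cube continuous_intros h simp: integral_const_cube)
  also have "\<dots> = 2 * \<epsilon> / I" using IJ by (simp add: \<kappa>_def flip: J_def)
  also have "\<dots> \<le> 2 * \<epsilon> / a"
    using IJ a \<epsilon>0 by (intro divide_left_mono) auto
  finally show ?thesis by (simp add: I_def J_def)
qed

section \<open>Normalised functions are conditional densities\<close>

lemma continuous_on_slice:
  assumes "continuous_on (S \<times> T) g" "z \<in> T"
  shows "continuous_on S (\<lambda>x. g (x, z))"
  by (rule continuous_on_compose2[OF assms(1)]) (use assms(2) in \<open>auto intro!: continuous_intros\<close>)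

lemma integral_cube_ge:
  fixes g :: "(real^'dx) \<times> (real^'dz) \<Rightarrow> real"
  assumes g: "continuous_on (unit_cube \<times> unit_cube) g"
    and ge: "\<And>x z. x \<in> unit_cube \<Longrightarrow> z \<in> unit_cube \<Longrightarrow> g (x, z) \<ge> a"
    and z: "z \<in> unit_cube"
  shows "a \<le> (LINT u:unit_cube|lborel. g (u, z))"
proof -
  have "a = (LINT u:(unit_cube :: (real^'dx) set)|lborel. a)"
    by (simp add: integral_const_cube)
  also have "\<dots> \<le> (LINT u:unit_cube|lborel. g (u, z))"
    using ge z by (intro integral_cube_mono continuous_intros continuous_on_slice[OF g]) auto
  finally show ?thesis .
qed

lemma cond_density_normalised:
  fixes g :: "(real^'dx) \<times> (real^'dz) \<Rightarrow> real"
  assumes a: "a > 0"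
    and g: "continuous_on (unit_cube \<times> unit_cube) g"
    and ge: "\<And>x z. x \<in> unit_cube \<Longrightarrow> z \<in> unit_cube \<Longrightarrow> g (x, z) \<ge> a"
    and p: "\<And>x z. x \<in> unit_cube \<Longrightarrow> z \<in> unit_cube \<Longrightarrow>
      p x z = g (x, z) / (LINT u:unit_cube|lborel. g (u, z))"
  shows "cond_density p"
proof -
  define I where "I z = (LINT u:unit_cube|lborel. g (u, z))" for z
  have I: "a \<le> I z" if "z \<in> unit_cube" for z
    unfolding I_def by (rule integral_cube_ge[OF g ge that])
  have p: "p x z = g (x, z) / I z" if "x \<in> unit_cube" "z \<in> unit_cube" for x z
    using p that by (simp add: I_def)
  have "continuous_on (unit_cube \<times> unit_cube) (\<lambda>(z, u). g (u, z))"
    unfolding case_prod_beta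
    by (rule continuous_on_compose2[OF g]) (auto intro!: continuous_intros)
  then have "continuous_on unit_cube (\<lambda>z. integral unit_cube (\<lambda>u. g (u, z)))"
    by (rule integral_continuous_on_param)
  then have "continuous_on unit_cube I"
    by (rule continuous_on_cong[THEN iffD1, rotated -1])
      (auto simp: I_def set_borel_integral_eq_integral(2)[OF set_integrable_cube]
        continuous_on_slice[OF g])
  then have "continuous_on (unit_cube \<times> unit_cube) (\<lambda>w :: (real^'dx) \<times> (real^'dz). I (snd w))"
    by (rule continuous_on_compose2) (auto intro!: continuous_intros)
  then have "continuous_on (unit_cube \<times> unit_cube) (\<lambda>w. g w / I (snd w))"
    using I a by (intro continuous_intros g) force+
  then have "continuous_on (unit_cube \<times> unit_cube) (\<lambda>(x, z). p x z)"
    by (rule continuous_on_cong[THEN iffD1, rotated -1]) (auto simp: p)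
  then have "set_borel_measurable borel (unit_cube \<times> unit_cube) (\<lambda>(x, z). p x z)"
    unfolding set_borel_measurable_def
    by (intro borel_measurable_continuous_on_indicator borel_closed closed_Times closed_cbox)
  moreover have "0 \<le> p x z" if "x \<in> unit_cube" "z \<in> unit_cube" for x z
    using p[OF that] ge[OF that] I[OF that(2)] a by simp
  moreover have "(LINT x:unit_cube|lborel. p x z) = 1" if z: "z \<in> unit_cube" for z
  proof -
    have "(LINT x:unit_cube|lborel. p x z) = (LINT x:unit_cube|lborel. g (x, z) / I z)"
      by (rule set_lebesgue_integral_cong) (auto simp: p z)
    also have "\<dots> = 1" using I[OF z] a by (simp add: I_def)
    finally show ?thesis .
  qed
  ultimately show ?thesis unfolding cond_density_def by blast
qed

section \<open>Membership in the smoothness classes\<close>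

lemma holder_class_antimono:
  assumes \<gamma>: "0 < \<gamma>" "\<gamma> \<le> 1"
  shows "(holder_class \<beta> 1 :: (real^'dx \<Rightarrow> real^'dz \<Rightarrow> real) set) \<subseteq> holder_class \<beta> \<gamma>"
proof
  fix p :: "real^'dx \<Rightarrow> real^'dz \<Rightarrow> real"
  assume "p \<in> holder_class \<beta> 1"
  then obtain W\<^sub>1 W\<^sub>2 where W: "cond_density p" "W\<^sub>1 > 0" "W\<^sub>2 > 0"
      "\<forall>z\<in>unit_cube. times_differentiable_on (strict_floor \<beta>) (\<lambda>x. p x z) unit_cube"
      "\<forall>x\<in>unit_cube. \<forall>x'\<in>unit_cube. \<forall>z\<in>unit_cube. \<forall>\<alpha>. mi_order \<alpha> = strict_floor \<beta> \<longrightarrow>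
          \<bar>mi_deriv unit_cube \<alpha> (\<lambda>x. p x z) x - mi_deriv unit_cube \<alpha> (\<lambda>x. p x z) x'\<bar>
            \<le> W\<^sub>1 * l1_norm (x - x') powr (\<beta> - real (strict_floor \<beta>))"
    and TV: "\<And>z z'. z \<in> unit_cube \<Longrightarrow> z' \<in> unit_cube \<Longrightarrow>
          (LINT x:unit_cube|lborel. \<bar>p x z - p x z'\<bar>) \<le> W\<^sub>2 * l1_norm (z - z') powr 1"
    unfolding holder_class_def by blast
  define D where "D = real CARD('dz)"
  have D: "1 \<le> D" by (simp add: D_def Suc_leI)
  have "(LINT x:unit_cube|lborel. \<bar>p x z - p x z'\<bar>) \<le> (W\<^sub>2 * D) * l1_norm (z - z') powr \<gamma>"
    if z: "z \<in> unit_cube" "z' \<in> unit_cube" for z z'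
  proof -
    have "W\<^sub>2 * l1_norm (z - z') \<le> W\<^sub>2 * (D * l1_norm (z - z') powr \<gamma>)"
      using W(3) D \<gamma> l1_norm_diff_le_card[OF z]
      by (intro mult_left_mono le_mult_powr l1_norm_nonneg) (auto simp: D_def)
    then show ?thesis using TV[OF z] by (simp add: l1_norm_nonneg mult.assoc)
  qed
  moreover have "W\<^sub>2 * D > 0" using W(3) D by simp
  ultimately show "p \<in> holder_class \<beta> \<gamma>"
    unfolding holder_class_def using W by blast
qed

text \<open>The multi-indices \<open>(0, e\<^sub>i)\<close> reach every first partial derivative in \<open>z\<close>, so when \<open>k = 1\<close> the
  Hoelder bound itself keeps it within a bounded distance of its value at the origin. When
  \<open>k \<ge> 2\<close> the Hoelder bound is not about first derivatives, but these are still differentiable,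
  hence continuous, and compactness takes over.\<close>

lemma bounded_partials_of_holder:
  fixes g :: "(real^'dx) \<times> (real^'dz) \<Rightarrow> real"
  assumes k: "0 < k" and \<theta>: "0 \<le> \<theta>"
    and g_diff: "times_differentiable_on k g (unit_cube \<times> unit_cube)"
    and g_holder: "\<And>x z x' z' \<alpha>\<^sub>x \<alpha>\<^sub>z.
      x \<in> unit_cube \<Longrightarrow> z \<in> unit_cube \<Longrightarrow> x' \<in> unit_cube \<Longrightarrow> z' \<in> unit_cube \<Longrightarrow>
      mi_order \<alpha>\<^sub>x + mi_order \<alpha>\<^sub>z = k \<Longrightarrow>
      \<bar>mi_deriv_joint (unit_cube \<times> unit_cube) (\<alpha>\<^sub>x, \<alpha>\<^sub>z) g (x, z)
        - mi_deriv_joint (unit_cube \<times> unit_cube) (\<alpha>\<^sub>x, \<alpha>\<^sub>z) g (x', z')\<bar>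
      \<le> C * (l1_norm (x - x') + l1_norm (z - z')) powr \<theta>"
  obtains B where "0 \<le> B" "\<And>i w. w \<in> unit_cube \<times> unit_cube \<Longrightarrow>
      \<bar>partial_deriv (unit_cube \<times> unit_cube) (0, axis i 1) g w\<bar> \<le> B"
proof -
  let ?S = "unit_cube \<times> unit_cube :: ((real^'dx) \<times> (real^'dz)) set"
  let ?d = "\<lambda>i. partial_deriv ?S (0, axis i 1) g"
  have "\<exists>b\<ge>0. \<forall>w\<in>?S. \<bar>?d i w\<bar> \<le> b" for i
  proof (cases "k = 1")
    case True
    define b where "b = \<bar>?d i (0, 0)\<bar> + \<bar>C\<bar> * (real CARD('dx) + real CARD('dz)) powr \<theta>"
    have "\<bar>?d i (x, z)\<bar> \<le> b" if xz: "x \<in> unit_cube" "z \<in> unit_cube" for x z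
    proof -
      have "\<bar>?d i (x, z) - ?d i (0, 0)\<bar> \<le> C * (l1_norm (x - 0) + l1_norm (z - 0)) powr \<theta>"
        using g_holder[of x z 0 0 0 "axis i 1"] xz True
        by (simp add: zero_mem_unit_cube mi_order_zero mi_order_axis mi_deriv_joint_single_variable
            del: One_nat_def)
      also have "\<dots> \<le> \<bar>C\<bar> * (l1_norm (x - 0) + l1_norm (z - 0)) powr \<theta>"
        by (intro mult_right_mono) auto
      also have "\<dots> \<le> \<bar>C\<bar> * (real CARD('dx) + real CARD('dz)) powr \<theta>"
        using \<theta> xz
        by (intro mult_left_mono powr_mono2 add_mono add_nonneg_nonneg l1_norm_nonneg
            l1_norm_diff_le_card zero_mem_unit_cube) auto
      finally show ?thesis unfolding b_def by linarith
    qed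
    moreover have "0 \<le> b" by (simp add: b_def)
    ultimately show ?thesis by blast
  next
    case False
    with k obtain m where m: "k = Suc (Suc m)" by (metis One_nat_def not0_implies_Suc neq0_conv)
    have "(0, axis i 1) \<in> (Basis :: ((real^'dx) \<times> (real^'dz)) set)"
      by (auto simp: Basis_prod_def Basis_vec_def)
    then have "?d i differentiable_on ?S"
      using g_diff m by simp
    then have "compact (?d i ` ?S)"
      by (intro compact_continuous_image differentiable_imp_continuous_on compact_Times compact_cbox)
    then obtain b where b: "\<forall>w\<in>?S. \<bar>?d i w\<bar> \<le> b"
      by (auto dest!: compact_imp_bounded simp: bounded_iff)
    have "(0, 0) \<in> ?S" by (simp add: zero_mem_unit_cube)
    with b have "\<bar>?d i (0, 0)\<bar> \<le> b" by blast
    then have "0 \<le> b" by linarith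
    with b show ?thesis by blast
  qed
  then obtain b where b: "\<And>i. 0 \<le> b i" "\<And>i w. w \<in> ?S \<Longrightarrow> \<bar>?d i w\<bar> \<le> b i"
    by metis
  show thesis
  proof (rule that)
    show "0 \<le> (\<Sum>i\<in>UNIV. b i)" by (simp add: b(1) sum_nonneg)
    show "\<bar>?d i w\<bar> \<le> (\<Sum>i\<in>UNIV. b i)" if "w \<in> ?S" for i w
      using b(2)[OF that, of i] member_le_sum[of i UNIV b] b(1) by force
  qed
qed

theorem theorem5p1:
  fixes g :: "(real^'dx) \<times> (real^'dz) \<Rightarrow> real"
    and p :: "real^'dx \<Rightarrow> real^'dz \<Rightarrow> real"
    and \<beta> a C :: real
  assumes a_pos: "a > 0"
    and g_ge: "\<And>x z. x \<in> unit_cube \<Longrightarrow> z \<in> unit_cube \<Longrightarrow> g (x, z) \<ge> a"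
    and beta: "\<beta> > 1"
    and g_diff: "times_differentiable_on (strict_floor \<beta>) g (unit_cube \<times> unit_cube)"
    and g_holder: "\<And>x z x' z' \<alpha>\<^sub>x \<alpha>\<^sub>z.
      x \<in> unit_cube \<Longrightarrow> z \<in> unit_cube \<Longrightarrow> x' \<in> unit_cube \<Longrightarrow> z' \<in> unit_cube \<Longrightarrow>
      mi_order \<alpha>\<^sub>x + mi_order \<alpha>\<^sub>z = strict_floor \<beta> \<Longrightarrow>
      \<bar>mi_deriv_joint (unit_cube \<times> unit_cube) (\<alpha>\<^sub>x, \<alpha>\<^sub>z) g (x, z)
        - mi_deriv_joint (unit_cube \<times> unit_cube) (\<alpha>\<^sub>x, \<alpha>\<^sub>z) g (x', z')\<bar>
      \<le> C * (l1_norm (x - x') + l1_norm (z - z')) powr (\<beta> - real (strict_floor \<beta>))"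
    and p_def: "\<And>x z. x \<in> unit_cube \<Longrightarrow> z \<in> unit_cube \<Longrightarrow>
      p x z = g (x, z) / (LINT u:unit_cube|lborel. g (u, z))"
  shows "p \<in> holder_class \<beta> 1 \<and>
    (\<forall>\<gamma>. 0 < \<gamma> \<and> \<gamma> \<le> 1 \<longrightarrow>
      (holder_class \<beta> 1 :: (real^'dx \<Rightarrow> real^'dz \<Rightarrow> real) set) \<subseteq> holder_class \<beta> \<gamma>)"
proof (intro conjI allI impI; (elim conjE)?)
  show "(holder_class \<beta> 1 :: (real^'dx \<Rightarrow> real^'dz \<Rightarrow> real) set) \<subseteq> holder_class \<beta> \<gamma>"
    if "0 < \<gamma>" "\<gamma> \<le> 1" for \<gamma>
    using that by (rule holder_class_antimono)
next
  let ?S = "unit_cube \<times> unit_cube :: ((real^'dx) \<times> (real^'dz)) set"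
  define k where "k = strict_floor \<beta>"
  define \<theta> where "\<theta> = \<beta> - real k"
  define I where "I z = (LINT u:unit_cube|lborel. g (u, z))" for z
  have k: "0 < k"
    using strict_floor_greatest(2)[of \<beta> 1] beta by (simp add: k_def)
  have \<theta>: "0 \<le> \<theta>"
    using strict_floor_greatest(1)[of \<beta>] beta by (simp add: \<theta>_def k_def)
  have g_diff': "g differentiable_on ?S"
    using g_diff k by (cases k) (auto simp: k_def)
  then have g_cont: "continuous_on ?S g"
    by (rule differentiable_imp_continuous_on)
  have I: "a \<le> I z" if "z \<in> unit_cube" for z
    unfolding I_def by (rule integral_cube_ge[OF g_cont g_ge that])
  have p: "p x z = g (x, z) / I z" if "x \<in> unit_cube" "z \<in> unit_cube" for x z
    using p_def that by (simp add: I_def)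

  have slice: "((\<lambda>x. (x, z)) has_derivative (\<lambda>v. (v, 0))) (at w within unit_cube)"
    for w :: "real^'dx" and z :: "real^'dz"
    by (auto intro!: derivative_eq_intros)
  have slice_basis: "(\<lambda>v. (v, 0)) ` Basis \<subseteq> (Basis :: ((real^'dx) \<times> (real^'dz)) set)"
    by (auto simp: Basis_prod_def)

  have p_diff: "times_differentiable_on k (\<lambda>x. p x z) unit_cube" if z: "z \<in> unit_cube" for z
    by (rule times_differentiable_on_pullback[where c = "1 / I z", OF unit_cube_nondegenerate slice
          _ slice_basis g_diff[folded k_def]])
      (use z in \<open>auto simp: p\<close>)

  have p_deriv: "mi_deriv unit_cube \<alpha> (\<lambda>x. p x z) x = mi_deriv_joint ?S (\<alpha>, 0) g (x, z) / I z"
    if x: "x \<in> unit_cube" and z: "z \<in> unit_cube" and \<alpha>: "mi_order \<alpha> = k" for \<alpha> x z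
  proof -
    have "foldr (partial_deriv unit_cube) (mi_directions \<alpha>) (\<lambda>x. p x z) x
        = 1 / I z * foldr (partial_deriv ?S) (map (\<lambda>v. (v, 0)) (mi_directions \<alpha>)) g (x, z)"
      by (rule foldr_partial_deriv_pullback[OF unit_cube_nondegenerate slice _ slice_basis _
            set_mi_directions])
        (use x z \<alpha> g_diff in \<open>auto simp: p length_mi_directions k_def\<close>)
    then show ?thesis
      by (simp add: mi_deriv_def mi_deriv_joint_single_variable)
  qed

  \<comment> \<open>Adding \<open>1\<close> to a nonnegative constant makes it positive, as the class requires.\<close>
  define W\<^sub>1 where "W\<^sub>1 = \<bar>C\<bar> / a + 1"
  have p_holder: "\<bar>mi_deriv unit_cube \<alpha> (\<lambda>x. p x z) x - mi_deriv unit_cube \<alpha> (\<lambda>x. p x z) x'\<bar>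
      \<le> W\<^sub>1 * l1_norm (x - x') powr \<theta>"
    if x: "x \<in> unit_cube" "x' \<in> unit_cube" and z: "z \<in> unit_cube" and \<alpha>: "mi_order \<alpha> = k"
    for x x' z \<alpha>
  proof -
    let ?N = "l1_norm (x - x') powr \<theta>"
    let ?D = "mi_deriv_joint ?S (\<alpha>, 0) g"
    have "\<bar>?D (x, z) - ?D (x', z)\<bar> \<le> C * ?N"
      using g_holder[of x z x' z \<alpha> 0] x z \<alpha>
      by (simp add: mi_order_zero l1_norm_zero \<theta>_def k_def)
    also have "\<dots> \<le> \<bar>C\<bar> * ?N" by (intro mult_right_mono) auto
    finally have D: "\<bar>?D (x, z) - ?D (x', z)\<bar> \<le> \<bar>C\<bar> * ?N" .
    have "\<bar>mi_deriv unit_cube \<alpha> (\<lambda>x. p x z) x - mi_deriv unit_cube \<alpha> (\<lambda>x. p x z) x'\<bar>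
        = \<bar>?D (x, z) - ?D (x', z)\<bar> / I z"
      using I[OF z] a_pos x z \<alpha> by (simp add: p_deriv flip: diff_divide_distrib)
    also have "\<dots> \<le> (\<bar>C\<bar> * ?N) / a"
      using D I[OF z] a_pos by (intro frac_le) auto
    also have "\<dots> \<le> W\<^sub>1 * ?N"
      by (simp add: W\<^sub>1_def distrib_right)
    finally show ?thesis .
  qed

  obtain B where B: "0 \<le> B" "\<And>i w. w \<in> ?S \<Longrightarrow> \<bar>partial_deriv ?S (0, axis i 1) g w\<bar> \<le> B"
    by (rule bounded_partials_of_holder[OF k \<theta> g_diff[folded k_def]
          g_holder[folded k_def, folded \<theta>_def]], assumption+) (rule that)
  define W\<^sub>2 where "W\<^sub>2 = 2 * B / a + 1"
  have p_TV: "(LINT x:unit_cube|lborel. \<bar>p x z - p x z'\<bar>) \<le> W\<^sub>2 * l1_norm (z - z') powr 1"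
    if z: "z \<in> unit_cube" "z' \<in> unit_cube" for z z'
  proof -
    have "(LINT x:unit_cube|lborel. \<bar>p x z - p x z'\<bar>)
        = (LINT x:unit_cube|lborel. \<bar>g (x, z) / I z - g (x, z') / I z'\<bar>)"
      by (rule set_lebesgue_integral_cong) (auto simp: p z)
    also have "\<dots> \<le> 2 * (B * l1_norm (z - z')) / a"
      unfolding I_def
    proof (rule normalised_L1_distance)
      show "\<bar>g (x, z) - g (x, z')\<bar> \<le> B * l1_norm (z - z')" if "x \<in> unit_cube" for x
        by (rule lipschitz_in_second_argument[OF g_diff' B(2) that z])
      show "0 \<le> g (x, z')" if "x \<in> unit_cube" for x
        using g_ge[OF that z(2)] a_pos by linarith
    qed (use a_pos z I in \<open>auto simp: I_def intro!: continuous_on_slice[OF g_cont]\<close>)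
    also have "\<dots> \<le> W\<^sub>2 * l1_norm (z - z') powr 1"
      using l1_norm_nonneg[of "z - z'"] by (simp add: W\<^sub>2_def distrib_right)
    finally show ?thesis .
  qed

  have "cond_density p"
    by (rule cond_density_normalised[OF a_pos g_cont g_ge p_def])
  moreover have "W\<^sub>1 > 0" "W\<^sub>2 > 0"
    using a_pos B(1) by (auto simp: W\<^sub>1_def W\<^sub>2_def intro!: add_nonneg_pos)
  ultimately show "p \<in> holder_class \<beta> 1"
    unfolding holder_class_def using p_diff p_holder p_TV unfolding k_def \<theta>_def by blast
qed

end
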